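(* Let $d \ge 1$ be an integer, let $R = \mathbb{Q}[a_{1,1},a_{1,2},a_{2,1},a_{2,2}]$ with the $a_{i,j}$ indeterminates, let $t$ be a further indeterminate, and let $f=(f_1,f_2)$ be given by \[ f_i(x_1,x_2) = x_i - \bigl(t(a_{i,1}x_1 + a_{i,2}x_2)\bigr)^d, \qquad i=1,2. \] Let $g = (g_1,g_2)$, $g_i \in R[[t,x_1,x_2]]$, be the formal inverse of $f$. Then all but finitely many of the coefficients (in $R$) of the monomials $t^N x_1^{\alpha(1)} x_2^{\alpha(2)}$ in $g_1$ and $g_2$ lie in the ideal $J_{d,2}$ of $R$.
   Context: The formal inverse $g$ is the pair of formal power series $g_i \in R[[t,x_1,x_2]]$, with $g_i \equiv x_i$ modulo $t$, which is inverse to $f$ under composition in the variables $x = (x_1,x_2)$: $f(g(x)) = x = g(f(x))$. The Jacobian is $\mathrm{Jac}(f)(x) = \det\bigl(\partial f_i/\partial x_j\bigr)_{1 \le i,j \le 2} \in R[t,x_1,x_2]$. The ideal $J_{d,2} \subset R$ is the ideal generated by the coefficients (elements of $R$) of all monomials in $t,x_1,x_2$ in $\mathrm{Jac}(f)(x)$, omitting the constant term $1$. *)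

theory Defs
  imports
    "HOL-Analysis.Determinants"
    "HOL-Computational_Algebra.Formal_Power_Series"
    "HOL-Library.Poly_Mapping"
begin

text \<open>
  The ring \<open>R = \<rat>[a\<^sub>1\<^sub>1, a\<^sub>1\<^sub>2, a\<^sub>2\<^sub>1, a\<^sub>2\<^sub>2]\<close>. The two-element type \<open>2\<close> is the index set \<open>{1, 2}\<close>
  (its numeral \<open>2\<close> denotes the element other than \<open>1\<close>).
\<close>

type_synonym coeff_ring = "((2 \<times> 2) \<Rightarrow>\<^sub>0 nat) \<Rightarrow>\<^sub>0 rat"

definition a_var :: "2 \<Rightarrow> 2 \<Rightarrow> coeff_ring" where
  "a_var i j = Poly_Mapping.single (Poly_Mapping.single (i, j) 1) 1"

text \<open>
  \<open>A[[t, x\<^sub>1, x\<^sub>2]]\<close> is represented as \<open>A[[x\<^sub>2]][[x\<^sub>1]][[t]]\<close>; the coefficient of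
  \<open>t\<^sup>N x\<^sub>1\<^sup>p x\<^sub>2\<^sup>q\<close> in \<open>G\<close> is \<open>coeff3 G N p q\<close>. Polynomials in \<open>t, x\<^sub>1, x\<^sub>2\<close> are treated as
  elements of this ring.
\<close>

type_synonym 'a fps3 = "'a fps fps fps"

definition coeff3 :: "'a fps3 \<Rightarrow> nat \<Rightarrow> nat \<Rightarrow> nat \<Rightarrow> 'a" where
  "coeff3 G N p q = fps_nth (fps_nth (fps_nth G N) p) q"

definition Abs_fps3 :: "(nat \<Rightarrow> nat \<Rightarrow> nat \<Rightarrow> 'a) \<Rightarrow> 'a fps3" where
  "Abs_fps3 c = Abs_fps (\<lambda>N. Abs_fps (\<lambda>p. Abs_fps (\<lambda>q. c N p q)))"

definition const3 :: "'a::comm_ring_1 \<Rightarrow> 'a fps3" where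
  "const3 c = fps_const (fps_const (fps_const c))"

definition t_var :: "'a::comm_ring_1 fps3" where
  "t_var = fps_X"

definition x_var :: "2 \<Rightarrow> 'a::comm_ring_1 fps3" where
  "x_var i = (if i = 1 then fps_const fps_X else fps_const (fps_const fps_X))"

definition partial_x :: "2 \<Rightarrow> 'a::comm_ring_1 fps3 \<Rightarrow> 'a fps3" where
  "partial_x j G =
    (if j = 1 then Abs_fps (\<lambda>N. fps_deriv (fps_nth G N))
     else Abs_fps (\<lambda>N. Abs_fps (\<lambda>p. fps_deriv (fps_nth (fps_nth G N) p))))"

definition Jac :: "(2 \<Rightarrow> 'a::comm_ring_1 fps3) \<Rightarrow> 'a fps3" where
  "Jac f = det (\<chi> i j. partial_x j (f i))"

text \<open>
  Substitution \<open>G(t, h\<^sub>1, h\<^sub>2) = \<Sum> G\<^sub>N\<^sub>p\<^sub>q t\<^sup>N h\<^sub>1\<^sup>p h\<^sub>2\<^sup>q\<close>, computed coefficientwise. Each of the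
  sums has only finitely many nonzero terms if \<open>G\<close> is a polynomial, or if \<open>h\<^sub>1\<close> and \<open>h\<^sub>2\<close> have
  zero constant term; \<open>Sum_any\<close> returns \<open>0\<close> for sums with infinitely many nonzero terms.
\<close>

definition subst_x :: "'a::comm_ring_1 fps3 \<Rightarrow> (2 \<Rightarrow> 'a fps3) \<Rightarrow> 'a fps3" where
  "subst_x G h = Abs_fps3 (\<lambda>n k l.
     Sum_any (\<lambda>(N, p, q). coeff3 G N p q * coeff3 (t_var ^ N * h 1 ^ p * h 2 ^ q) n k l))"

definition formal_inverse :: "(2 \<Rightarrow> 'a::comm_ring_1 fps3) \<Rightarrow> (2 \<Rightarrow> 'a fps3) \<Rightarrow> bool" where
  "formal_inverse f g \<longleftrightarrow>
     (\<forall>i. t_var dvd (g i - x_var i)) \<and>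
     (\<forall>i. subst_x (f i) g = x_var i) \<and>
     (\<forall>i. subst_x (g i) f = x_var i)"

definition f_map :: "nat \<Rightarrow> 2 \<Rightarrow> coeff_ring fps3" where
  "f_map d i = x_var i - (t_var * (\<Sum>j\<in>UNIV. const3 (a_var i j) * x_var j)) ^ d"

text \<open>\<open>module.span (*) S\<close> is the ideal generated by \<open>S\<close>.\<close>

definition J_ideal :: "nat \<Rightarrow> coeff_ring set" where
  "J_ideal d = module.span (*)
     {coeff3 (Jac (f_map d)) N p q | N p q. (N, p, q) \<noteq> (0, 0, 0)}"

end

(*
  Write A = (a_ij), D = det A, L_i = a_i1 x_1 + a_i2 x_2, y_i = L_i(g). The equation f(g) = x says
  g_i = x_i + t^d y_i^d. Modulo the coefficients of the t^d-part a_11 L_1^(d-1) + a_22 L_2^(d-1) of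
  the Jacobian, the form a_i1 L_1^d + a_i2 L_2^d is congruent to -D c_i x_i^d with c_1 = a_21^(d-1),
  c_2 = a_12^(d-1); substituting g for x gives y_i = L_i - t^d D c_i g_i^d modulo J. Hence if the
  g_i are polynomials modulo J + (D^k), they are polynomials modulo J + (D^(k+1)). Finally D is
  nilpotent modulo J, because D L_1^(d-1) L_2^(d-1) vanishes modulo J.
*)

theory Submission
  imports Defs
begin

section \<open>Ideals of a commutative ring\<close>

text \<open>The argument moves between \<open>J_ideal d\<close>, its radical and the ideals J +
  (D^k); all of these are instances.\<close>

locale ring_ideal =
  fixes I :: "'a::comm_ring_1 set"
  assumes zero_mem: "0 \<in> I"
    and add_mem: "x \<in> I \<Longrightarrow> y \<in> I \<Longrightarrow> x + y \<in> I"
    and mult_mem: "y \<in> I \<Longrightarrow> x * y \<in> I"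
begin

lemma mult_mem_right: "x \<in> I \<Longrightarrow> x * y \<in> I"
  using mult_mem[of x y] by (simp add: mult.commute)

lemma uminus_mem: "x \<in> I \<Longrightarrow> - x \<in> I"
  using mult_mem[of x "-1"] by simp

lemma diff_mem: "x \<in> I \<Longrightarrow> y \<in> I \<Longrightarrow> x - y \<in> I"
  using add_mem[of x "- y"] uminus_mem[of y] by simp

lemma sum_mem: "(\<And>i. i \<in> S \<Longrightarrow> f i \<in> I) \<Longrightarrow> sum f S \<in> I"
  by (induction S rule: infinite_finite_induct) (auto intro: zero_mem add_mem)

lemma dvd_mem: "x \<in> I \<Longrightarrow> x dvd y \<Longrightarrow> y \<in> I"
  by (auto simp: dvd_def intro: mult_mem_right)

definition radical :: "'a set" where
  "radical = {x. \<exists>n. x ^ n \<in> I}"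

lemma mem_radical: "x \<in> I \<Longrightarrow> x \<in> radical"
  by (auto simp: radical_def intro: exI[of _ 1])

lemma mem_radical_if_power: "x ^ n \<in> radical \<Longrightarrow> x \<in> radical"
  by (auto simp: radical_def simp flip: power_mult)

text \<open>Every term of the binomial expansion of (x + y)^(m + n) is divisible by x^m or by
  y^n.\<close>

lemma ring_ideal_radical: "ring_ideal radical"
proof
  show "0 \<in> radical"
    by (rule mem_radical) (rule zero_mem)
next
  fix x y
  assume "x \<in> radical" "y \<in> radical"
  then obtain m n where x: "x ^ m \<in> I" and y: "y ^ n \<in> I"
    by (auto simp: radical_def)
  have "(x + y) ^ (m + n) \<in> I"
    unfolding binomial_ring
  proof (rule sum_mem)
    fix k assume "k \<in> {..m + n}"
    then consider "m \<le> k" | "n \<le> m + n - k"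
      by fastforce
    then show "of_nat (m + n choose k) * x ^ k * y ^ (m + n - k) \<in> I"
    proof cases
      case 1
      then show ?thesis
        by (intro dvd_mem[OF x]) (simp add: le_imp_power_dvd)
    next
      case 2
      then show ?thesis
        by (intro dvd_mem[OF y]) (simp add: le_imp_power_dvd)
    qed
  qed
  then show "x + y \<in> radical"
    by (auto simp: radical_def)
next
  fix x y
  assume "y \<in> radical"
  then show "x * y \<in> radical"
    by (auto simp: radical_def power_mult_distrib intro: mult_mem)
qed

text \<open>This set is I + (c); the final induction takes for \<open>c\<close> the powers of the
  determinant.\<close>

lemma ring_ideal_adjoin: "ring_ideal {j + c * r | j r. j \<in> I}"
proof
  show "0 \<in> {j + c * r | j r. j \<in> I}"
    using zero_mem by (auto intro!: exI[of _ 0])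
next
  fix x y
  assume "x \<in> {j + c * r | j r. j \<in> I}" "y \<in> {j + c * r | j r. j \<in> I}"
  then obtain j r j' r' where "x = j + c * r" "y = j' + c * r'" "j \<in> I" "j' \<in> I"
    by auto
  then have "x + y = (j + j') + c * (r + r')" "j + j' \<in> I"
    by (auto simp: algebra_simps intro: add_mem)
  then show "x + y \<in> {j + c * r | j r. j \<in> I}"
    by blast
next
  fix x y
  assume "y \<in> {j + c * r | j r. j \<in> I}"
  then obtain j r where "y = j + c * r" "j \<in> I"
    by auto
  then have "x * y = x * j + c * (x * r)" "x * j \<in> I"
    by (auto simp: algebra_simps intro: mult_mem_right)
  then show "x * y \<in> {j + c * r | j r. j \<in> I}"
    by blast
qed

end

lemma module_mult_self: "module ((*) :: 'a \<Rightarrow> 'a \<Rightarrow> 'a::comm_ring_1)"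
  by standard (simp_all add: algebra_simps)

lemma ring_ideal_J: "ring_ideal (J_ideal d)"
  unfolding J_ideal_def
  by standard
    (use module.span_zero[OF module_mult_self] module.span_add[OF module_mult_self]
      module.span_scale[OF module_mult_self] in auto)

section \<open>Coefficients of power series in three variables\<close>

lemma fps3_eqI: "(\<And>N p q. coeff3 F N p q = coeff3 G N p q) \<Longrightarrow> F = G"
  by (simp add: coeff3_def fps_eq_iff)

lemma coeff3_add [simp]: "coeff3 (F + G) N p q = coeff3 F N p q + coeff3 G N p q"
  and coeff3_diff [simp]: "coeff3 (F - G) N p q = coeff3 F N p q - coeff3 G N p q"
  and coeff3_zero [simp]: "coeff3 0 N p q = 0"
  for F G :: "'a::comm_ring_1 fps3"
  by (simp_all add: coeff3_def)

lemma coeff3_sum: "coeff3 (\<Sum>i\<in>S. F i) N p q = (\<Sum>i\<in>S. coeff3 (F i) N p q)"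
  by (simp add: coeff3_def fps_sum_nth)

lemma coeff3_mult:
  "coeff3 (F * G) N p q =
    (\<Sum>i\<le>N. \<Sum>j\<le>p. \<Sum>k\<le>q. coeff3 F i j k * coeff3 G (N - i) (p - j) (q - k))"
  by (simp add: coeff3_def fps_mult_nth fps_sum_nth atLeast0AtMost)

lemma coeff3_Abs_fps3 [simp]: "coeff3 (Abs_fps3 c) N p q = c N p q"
  by (simp add: coeff3_def Abs_fps3_def)

lemma coeff3_const3_mult [simp]: "coeff3 (const3 c * F) N p q = c * coeff3 F N p q"
  by (simp add: coeff3_def const3_def)

lemma const3_simps:
  "const3 (c + c') = const3 c + const3 c'"
  "const3 (c - c') = const3 c - const3 c'"
  "const3 (- c) = - const3 c"
  "const3 (c * c') = const3 c * const3 c'"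
  "const3 (c ^ n) = const3 c ^ n"
  "const3 (of_nat n) = of_nat n"
  "const3 0 = 0"
  "const3 1 = 1"
  by (simp_all add: const3_def fps_of_nat)

text \<open>Terms \<open>const3 c * monom3 N p q\<close> serve as the normal form both for reading
  off coefficients and for evaluating \<open>subst_x\<close>.\<close>

definition monom3 :: "nat \<Rightarrow> nat \<Rightarrow> nat \<Rightarrow> 'a::comm_ring_1 fps3" where
  "monom3 N p q = t_var ^ N * x_var 1 ^ p * x_var 2 ^ q"

lemma coeff3_monom3 [simp]:
  "coeff3 (monom3 N p q) n k l = (if (n, k, l) = (N, p, q) then 1 else 0)"
proof -
  have "(monom3 N p q :: 'a fps3) = fps_const (fps_const (fps_X ^ q) * fps_X ^ p) * fps_X ^ N"
    by (simp add: monom3_def t_var_def x_var_def mult_ac)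
  then show ?thesis
    by (simp add: coeff3_def)
qed

section \<open>Partial derivatives\<close>

lemma partial_x_linear [simp]:
  "partial_x j (F - G) = partial_x j F - partial_x j G"
  "partial_x j (F + G) = partial_x j F + partial_x j G"
  by (simp_all add: partial_x_def fps_eq_iff algebra_simps)

text \<open>Lifts a derivation of the coefficient ring through one layer of the iterated power
  series. The x_1-derivative needs one lift, through t; the x_2-derivative needs two, through x_1
  and then t.\<close>

lemma coefficientwise_Leibniz:
  fixes \<delta> :: "'a::comm_ring_1 \<Rightarrow> 'a"
  assumes "\<And>x y. \<delta> (x + y) = \<delta> x + \<delta> y" "\<And>x y. \<delta> (x * y) = x * \<delta> y + \<delta> x * y"
  shows "Abs_fps (\<lambda>n. \<delta> (fps_nth (F * G) n)) =
    F * Abs_fps (\<lambda>n. \<delta> (fps_nth G n)) + Abs_fps (\<lambda>n. \<delta> (fps_nth F n)) * G"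
proof -
  have "\<delta> 0 = 0"
    using assms(1)[of 0 0] by simp
  then have "\<delta> (sum h S) = (\<Sum>i\<in>S. \<delta> (h i))" for h :: "nat \<Rightarrow> 'a" and S
    by (induction S rule: infinite_finite_induct) (simp_all add: assms(1))
  then show ?thesis
    by (simp add: fps_eq_iff fps_mult_nth assms(2) sum.distrib)
qed

lemma partial_x_mult: "partial_x j (F * G) = F * partial_x j G + partial_x j F * G"
proof (cases "j = 1")
  case True
  then show ?thesis
    unfolding partial_x_def by (simp add: coefficientwise_Leibniz)
next
  case False
  have "Abs_fps (\<lambda>N. (\<lambda>H. Abs_fps (\<lambda>p. fps_deriv (fps_nth H p))) (fps_nth (F * G) N)) =
    F * Abs_fps (\<lambda>N. (\<lambda>H. Abs_fps (\<lambda>p. fps_deriv (fps_nth H p))) (fps_nth G N)) +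
    Abs_fps (\<lambda>N. (\<lambda>H. Abs_fps (\<lambda>p. fps_deriv (fps_nth H p))) (fps_nth F N)) * G"
  proof (rule coefficientwise_Leibniz, goal_cases)
    case 1 show ?case by (simp add: fps_eq_iff algebra_simps)
  next
    case 2 show ?case by (rule coefficientwise_Leibniz) simp_all
  qed
  with False show ?thesis
    by (simp add: partial_x_def)
qed

lemma partial_x_const3 [simp]: "partial_x j (const3 c) = 0"
  and partial_x_t_var [simp]: "partial_x j t_var = 0"
  and partial_x_x_var [simp]: "partial_x j (x_var i) = (if i = j then 1 else 0)"
  using exhaust_2[of i] exhaust_2[of j]
  by (auto simp: partial_x_def const3_def t_var_def x_var_def fps_eq_iff fps_X_def)

text \<open>The truncated exponent \<open>n - 1\<close> is harmless at n = 0, where the factor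
  \<open>of_nat n\<close> vanishes.\<close>

lemma partial_x_power:
  "partial_x j (F ^ n) = of_nat n * F ^ (n - 1) * partial_x j F"
proof (induction n)
  case 0
  have "partial_x j 1 = 0"
    using partial_x_const3[of j 1] by (simp add: const3_simps)
  then show ?case by simp
next
  case (Suc n)
  then show ?case
    by (cases n) (simp_all add: partial_x_mult algebra_simps)
qed

section \<open>Substitution into polynomials\<close>

text \<open>Finite support is what makes the \<open>Sum_any\<close> in \<open>subst_x\<close>
  additive in its first argument, for arbitrary \<open>h\<close>.\<close>

definition is_polynomial :: "'a::comm_ring_1 fps3 \<Rightarrow> bool" where
  "is_polynomial G \<longleftrightarrow> finite {(N, p, q). coeff3 G N p q \<noteq> 0}"

lemma is_polynomial_0: "is_polynomial 0"
  by (simp add: is_polynomial_def case_prod_unfold)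

lemma is_polynomial_add:
  assumes "is_polynomial F" "is_polynomial G"
  shows "is_polynomial (F + G)"
proof -
  have "{(N, p, q). coeff3 (F + G) N p q \<noteq> 0} \<subseteq>
    {(N, p, q). coeff3 F N p q \<noteq> 0} \<union> {(N, p, q). coeff3 G N p q \<noteq> 0}"
    by auto
  with assms show ?thesis
    unfolding is_polynomial_def by (meson finite_Un finite_subset)
qed

lemma is_polynomial_monom: "is_polynomial (const3 c * monom3 N p q)"
  unfolding is_polynomial_def
  by (rule finite_subset[of _ "{(N, p, q)}"]) (auto split: if_splits)

lemma is_polynomial_sum: "(\<And>i. i \<in> S \<Longrightarrow> is_polynomial (F i)) \<Longrightarrow> is_polynomial (sum F S)"
proof (induction S rule: infinite_finite_induct)
  case (insert i S)
  then show ?case by (simp add: is_polynomial_add)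
qed (simp_all add: is_polynomial_0)

lemma subst_x_add:
  assumes "is_polynomial F" "is_polynomial G"
  shows "subst_x (F + G) h = subst_x F h + subst_x G h"
proof (rule fps3_eqI)
  fix n k l
  define m where "m = (\<lambda>(N, p, q). coeff3 (t_var ^ N * h 1 ^ p * h 2 ^ q) n k l)"
  have fin: "finite {s. (case s of (N, p, q) \<Rightarrow> coeff3 H N p q) * m s \<noteq> 0}"
    if "is_polynomial H" for H
    by (rule finite_subset[OF _ that[unfolded is_polynomial_def]]) auto
  have eq: "coeff3 (subst_x H h) n k l =
      Sum_any (\<lambda>s. (case s of (N, p, q) \<Rightarrow> coeff3 H N p q) * m s)" for H
    by (simp add: subst_x_def m_def case_prod_beta)
  show "coeff3 (subst_x (F + G) h) n k l = coeff3 (subst_x F h + subst_x G h) n k l"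
    unfolding eq coeff3_add Sum_any.distrib[OF fin[OF assms(1)] fin[OF assms(2)], symmetric]
    by (simp add: case_prod_beta algebra_simps)
qed

lemma subst_x_sum:
  assumes "\<And>i. i \<in> S \<Longrightarrow> is_polynomial (F i)"
  shows "subst_x (sum F S) h = (\<Sum>i\<in>S. subst_x (F i) h)"
  using assms
proof (induction S rule: infinite_finite_induct)
  case (insert i S)
  then show ?case by (simp add: subst_x_add is_polynomial_sum)
qed (simp_all add: subst_x_def Abs_fps3_def fps_eq_iff case_prod_beta)

text \<open>Only one index triple survives in the \<open>Sum_any\<close>, whatever \<open>h\<close>
  is.\<close>

lemma subst_x_monom:
  "subst_x (const3 c * monom3 N p q) h = const3 c * (t_var ^ N * h 1 ^ p * h 2 ^ q)"
proof (rule fps3_eqI)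
  fix n k l
  have "coeff3 (subst_x (const3 c * monom3 N p q) h) n k l =
      Sum_any (\<lambda>s. if s = (N, p, q) then c * coeff3 (t_var ^ N * h 1 ^ p * h 2 ^ q) n k l else 0)"
    unfolding subst_x_def coeff3_Abs_fps3
    by (rule arg_cong[of _ _ Sum_any]) auto
  then show "coeff3 (subst_x (const3 c * monom3 N p q) h) n k l =
      coeff3 (const3 c * (t_var ^ N * h 1 ^ p * h 2 ^ q)) n k l"
    by simp
qed

section \<open>Series that are polynomials modulo an ideal\<close>

definition coeffs_in :: "'a::comm_ring_1 set \<Rightarrow> 'a fps3 \<Rightarrow> bool" where
  "coeffs_in I G \<longleftrightarrow> (\<forall>N p q. coeff3 G N p q \<in> I)"

text \<open>A common bound on the three exponents replaces finiteness of the exceptional set, so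
  that bounds simply add under multiplication.\<close>

definition polynomial_mod :: "'a::comm_ring_1 set \<Rightarrow> 'a fps3 \<Rightarrow> bool" where
  "polynomial_mod I G \<longleftrightarrow>
    (\<exists>B. \<forall>N p q. N > B \<or> p > B \<or> q > B \<longrightarrow> coeff3 G N p q \<in> I)"

lemma finite_if_polynomial_mod:
  assumes "polynomial_mod I G"
  shows "finite {(N, p, q). coeff3 G N p q \<notin> I}"
proof -
  from assms obtain B where B: "\<And>N p q. N > B \<or> p > B \<or> q > B \<Longrightarrow> coeff3 G N p q \<in> I"
    by (auto simp: polynomial_mod_def)
  have "{(N, p, q). coeff3 G N p q \<notin> I} \<subseteq> {..B} \<times> {..B} \<times> {..B}"
    using B by (auto simp: not_less[symmetric])
  then show ?thesis
    by (rule finite_subset) simp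
qed

context ring_ideal
begin

lemma coeffs_in_mult: "coeffs_in I F \<Longrightarrow> coeffs_in I (F * G)"
  by (simp add: coeffs_in_def coeff3_mult sum_mem mult_mem_right)

lemma coeffs_in_add: "coeffs_in I F \<Longrightarrow> coeffs_in I G \<Longrightarrow> coeffs_in I (F + G)"
  by (simp add: coeffs_in_def add_mem)

lemma coeffs_in_sum: "(\<And>i. i \<in> S \<Longrightarrow> coeffs_in I (F i)) \<Longrightarrow> coeffs_in I (sum F S)"
  by (simp add: coeffs_in_def coeff3_sum sum_mem)

lemma coeffs_in_const3: "c \<in> I \<Longrightarrow> coeffs_in I (const3 c)"
  using coeff3_const3_mult[of c 1] by (simp add: coeffs_in_def mult_mem_right)

lemma polynomial_mod_if_coeffs_in: "coeffs_in I F \<Longrightarrow> polynomial_mod I F"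
  by (simp add: coeffs_in_def polynomial_mod_def)

lemma polynomial_mod_add:
  assumes "polynomial_mod I F" "polynomial_mod I G"
  shows "polynomial_mod I (F + G)"
proof -
  from assms obtain A B where
    "\<And>N p q. N > A \<or> p > A \<or> q > A \<Longrightarrow> coeff3 F N p q \<in> I"
    "\<And>N p q. N > B \<or> p > B \<or> q > B \<Longrightarrow> coeff3 G N p q \<in> I"
    unfolding polynomial_mod_def by blast
  then show ?thesis
    unfolding polynomial_mod_def by (intro exI[of _ "max A B"]) (auto intro: add_mem)
qed

lemma polynomial_mod_mult:
  assumes "polynomial_mod I F" "polynomial_mod I G"
  shows "polynomial_mod I (F * G)"
proof -
  from assms obtain A B where
    A: "\<And>N p q. N > A \<or> p > A \<or> q > A \<Longrightarrow> coeff3 F N p q \<in> I" and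
    B: "\<And>N p q. N > B \<or> p > B \<or> q > B \<Longrightarrow> coeff3 G N p q \<in> I"
    unfolding polynomial_mod_def by blast
  have "coeff3 (F * G) N p q \<in> I" if "N > A + B \<or> p > A + B \<or> q > A + B" for N p q
    unfolding coeff3_mult
  proof (intro sum_mem)
    fix i j k
    have "(i > A \<or> j > A \<or> k > A) \<or> (N - i > B \<or> p - j > B \<or> q - k > B)"
      using that by linarith
    then show "coeff3 F i j k * coeff3 G (N - i) (p - j) (q - k) \<in> I"
      by (meson A B mult_mem mult_mem_right)
  qed
  then show ?thesis
    unfolding polynomial_mod_def by blast
qed

lemma polynomial_mod_monom: "polynomial_mod I (const3 c * monom3 N p q)"
  unfolding polynomial_mod_def
  by (rule exI[of _ "max N (max p q)"]) (auto intro: zero_mem)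

lemma polynomial_mod_power: "polynomial_mod I F \<Longrightarrow> polynomial_mod I (F ^ n)"
proof (induction n)
  case 0
  show ?case
    using polynomial_mod_monom[of 1 0 0 0] by (simp add: const3_simps monom3_def)
qed (simp add: polynomial_mod_mult)

end

lemma linear_form_power:
  "(const3 a * X + const3 b * Y) ^ n =
    (\<Sum>k\<le>n. const3 (of_nat (n choose k) * (a ^ k * b ^ (n - k))) * (X ^ k * Y ^ (n - k)))"
  unfolding binomial_ring by (simp add: const3_simps power_mult_distrib mult_ac)

section \<open>Consequences of the Jacobian condition\<close>

context ring_ideal
begin

lemma determinant_mem_radical:
  assumes gen: "a * a ^ n + h * c ^ n \<in> I"
    and left: "(a * h - b * c) * (a ^ n * c ^ n) \<in> I"
    and middle: "(a * h - b * c) *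
      (\<Sum>k\<le>n. of_nat (n choose k) ^ 2 * ((a * h) ^ k * (b * c) ^ (n - k))) \<in> I"
  shows "a * h - b * c \<in> radical"
  \<comment> \<open>\<open>gen\<close> and \<open>left\<close> put \<open>D a\<close> into the radical; modulo \<open>D a\<close> only the term \<open>D (b c)\<^sup>n\<close> of
    \<open>middle\<close> survives, so \<open>D b c\<close> and hence \<open>D\<^sup>2 = D a h - D b c\<close> are in the radical.\<close>
proof -
  interpret radical: ring_ideal radical by (rule ring_ideal_radical)
  define D where "D = a * h - b * c"
  have "D * a ^ (Suc n + n) \<in> I"
  proof -
    \<comment> \<open>\<open>D * a ^ n\<close> times \<open>gen\<close> has a second term that is
      exactly \<open>h\<close> times \<open>left\<close>.\<close>
    have "D * a ^ (Suc n + n) = D * a ^ n * (a * a ^ n + h * c ^ n) - h * (D * (a ^ n * c ^ n))"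
      by (simp add: algebra_simps power_add)
    also have "\<dots> \<in> I"
      by (rule diff_mem[OF mult_mem[OF gen] mult_mem[OF left[folded D_def]]])
    finally show ?thesis .
  qed
  \<comment> \<open>The extra powers of \<open>D\<close> complete the product to a full power of
    \<open>D * a\<close>.\<close>
  then have "D ^ (n + n) * (D * a ^ (Suc n + n)) \<in> radical"
    by (intro mem_radical) (rule mult_mem)
  then have "(D * a) ^ (Suc n + n) \<in> radical"
    by (simp add: power_mult_distrib power_add mult_ac)
  then have Da: "D * a \<in> radical"
    by (rule mem_radical_if_power)
  define Q where
    "Q = (\<Sum>k\<in>{..n} - {0}. of_nat (n choose k) ^ 2 * ((a * h) ^ k * (b * c) ^ (n - k)))"
  have "D * Q \<in> radical"
  proof -
    have "a dvd Q"
      unfolding Q_def by (intro dvd_sum) (auto simp: gr0_conv_Suc mult.assoc)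
    then show ?thesis
      using radical.dvd_mem[OF Da] by (simp add: mult_dvd_mono)
  qed
  moreover have "D * ((b * c) ^ n + Q) \<in> radical"
    using mem_radical[OF middle] by (simp add: D_def Q_def sum.remove[of _ 0])
  ultimately have "D * ((b * c) ^ n + Q) - D * Q \<in> radical"
    by (rule radical.diff_mem[rotated])
  \<comment> \<open>Again the factor is chosen to complete a full power, here of
    \<open>D * (b * c)\<close>.\<close>
  then have "D ^ n * (b * c) * (D * (b * c) ^ n) \<in> radical"
    by (intro radical.mult_mem[where x = "D ^ n * (b * c)"]) (simp add: algebra_simps)
  then have "(D * (b * c)) ^ Suc n \<in> radical"
    by (simp add: power_mult_distrib mult_ac)
  then have "D * (b * c) \<in> radical"
    by (rule mem_radical_if_power)
  then have "h * (D * a) - D * (b * c) \<in> radical"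
    using radical.diff_mem[OF radical.mult_mem[OF Da]] by blast
  then have "D ^ 2 \<in> radical"
    by (simp add: D_def algebra_simps power2_eq_square)
  then show ?thesis
    unfolding D_def by (rule mem_radical_if_power)
qed

text \<open>Compare coefficients of X^k Y^(n+1-k). For k \<le> n the coefficient is a binomial
  coefficient times \<open>b\<close> times the k-th instance of \<open>gen\<close>. For k = n + 1
  the correction term cancels \<open>b * c ^ Suc n\<close> and leaves \<open>a\<close> times the
  instance k = n. \<open>X\<close> and \<open>Y\<close> are arbitrary series, so the components of g
  can be inserted directly.\<close>

lemma coeffs_in_combination:
  assumes gen: "\<And>k. k \<le> n \<Longrightarrow> a * (a ^ k * b ^ (n - k)) + h * (c ^ k * h ^ (n - k)) \<in> I"
  shows "coeffs_in I (const3 a * (const3 a * X + const3 b * Y) ^ Suc n +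
    const3 b * (const3 c * X + const3 h * Y) ^ Suc n +
    const3 ((a * h - b * c) * c ^ n) * X ^ Suc n)" (is "coeffs_in I ?F")
proof -
  define r where "r k = of_nat (Suc n choose k) *
    (a * (a ^ k * b ^ (Suc n - k)) + b * (c ^ k * h ^ (Suc n - k)))" for k
  have "?F = (\<Sum>k\<le>Suc n. const3 (r k) * (X ^ k * Y ^ (Suc n - k))) +
      const3 ((a * h - b * c) * c ^ n) * X ^ Suc n"
    unfolding linear_form_power sum_distrib_left sum.distrib[symmetric]
    by (intro arg_cong2[of _ _ _ _ "(+)"] sum.cong refl)
      (simp add: r_def const3_simps algebra_simps)
  also have "\<dots> = (\<Sum>k\<le>n. const3 (r k) * (X ^ k * Y ^ (Suc n - k))) +
      const3 (r (Suc n) + (a * h - b * c) * c ^ n) * X ^ Suc n"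
    by (simp add: const3_simps algebra_simps)
  also have "coeffs_in I \<dots>"
  proof -
    have "r k \<in> I" if "k \<le> n" for k
    proof -
      have "r k = of_nat (Suc n choose k) * (b * (a * (a ^ k * b ^ (n - k)) + h * (c ^ k * h ^ (n - k))))"
        using that by (simp add: r_def Suc_diff_le algebra_simps)
      then show ?thesis
        using gen[OF that] by (simp add: mult_mem)
    qed
    moreover have "r (Suc n) + (a * h - b * c) * c ^ n \<in> I"
    proof -
      have "r (Suc n) + (a * h - b * c) * c ^ n = a * (a * (a ^ n * b ^ (n - n)) + h * (c ^ n * h ^ (n - n)))"
        by (simp add: r_def algebra_simps)
      then show ?thesis
        using gen[of n] by (simp add: mult_mem)
    qed
    ultimately show ?thesis
      by (intro coeffs_in_add coeffs_in_sum coeffs_in_mult coeffs_in_const3) auto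
  qed
  finally show ?thesis .
qed

end

section \<open>The power-linear map\<close>

text \<open>Positive integers are units in R, with inverse the constant polynomial 1/n. This strips
  binomial coefficients and powers of d from the coefficients of the Jacobian.\<close>

lemma of_nat_mult_coeff_ring_cancel:
  fixes c :: coeff_ring
  assumes "n > 0" "of_nat n * c \<in> J_ideal d"
  shows "c \<in> J_ideal d"
proof -
  interpret ring_ideal "J_ideal d" by (rule ring_ideal_J)
  have "Poly_Mapping.single 0 (1 / of_nat n) * of_nat n = (1 :: coeff_ring)"
    using assms(1) by (simp add: mult_single flip: single_of_nat)
  then have "c = Poly_Mapping.single 0 (1 / of_nat n) * (of_nat n * c)"
    by (simp flip: mult.assoc)
  then show ?thesis
    using mult_mem[OF assms(2)] by metis
qed

lemma x_var_eq_monom3: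
  "x_var i = const3 1 * monom3 0 (if i = 1 then 1 else 0) (if i = 1 then 0 else 1)"
  using exhaust_2[of i] by (auto simp: monom3_def const3_simps)

text \<open>Since f_i is a polynomial, the substitution can be carried out monomial by monomial
  after a binomial expansion.\<close>

lemma subst_x_f_map:
  "subst_x (f_map d i) g = g i - (t_var * (\<Sum>j\<in>UNIV. const3 (a_var i j) * g j)) ^ d"
proof -
  define c where "c k = - (of_nat (d choose k) * (a_var i 1 ^ k * a_var i 2 ^ (d - k)))" for k
  \<comment> \<open>\<open>X\<close> and \<open>h\<close> stay general: the identity first expands
    f_i in the variables and later folds the result back with \<open>g\<close>.\<close>
  have expand: "X - (t_var * (\<Sum>j\<in>UNIV. const3 (a_var i j) * h j)) ^ d =
      X + (\<Sum>k\<le>d. const3 (c k) * (t_var ^ d * h 1 ^ k * h 2 ^ (d - k)))" for X h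
    unfolding sum_2 power_mult_distrib linear_form_power
    by (simp add: c_def const3_simps sum_distrib_left sum_negf mult_ac)
  have "subst_x (f_map d i) g = subst_x (x_var i + (\<Sum>k\<le>d. const3 (c k) * monom3 d k (d - k))) g"
    by (simp add: f_map_def expand monom3_def)
  also have "\<dots> = subst_x (x_var i) g + (\<Sum>k\<le>d. subst_x (const3 (c k) * monom3 d k (d - k)) g)"
    unfolding x_var_eq_monom3[of i]
    by (simp only: subst_x_add subst_x_sum is_polynomial_sum is_polynomial_monom)
  also have "\<dots> = g i + (\<Sum>k\<le>d. const3 (c k) * (t_var ^ d * g 1 ^ k * g 2 ^ (d - k)))"
    unfolding x_var_eq_monom3[of i] subst_x_monom
    using exhaust_2[of i] by (auto simp: const3_simps)
  finally show ?thesis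
    by (simp add: expand)
qed

section \<open>The Jacobian and its coefficients\<close>

abbreviation a11 :: coeff_ring where "a11 \<equiv> a_var 1 1"
abbreviation a12 :: coeff_ring where "a12 \<equiv> a_var 1 2"
abbreviation a21 :: coeff_ring where "a21 \<equiv> a_var 2 1"
abbreviation a22 :: coeff_ring where "a22 \<equiv> a_var 2 2"

text \<open>With d = n + 1 this is det(1 - d t^d diag(L_1^n, L_2^n) A): one, minus a trace, plus a
  determinant, in t-degrees 0, d and 2d.\<close>

lemma Jac_f_map:
  defines "L \<equiv> \<lambda>i. const3 (a_var i 1) * x_var 1 + const3 (a_var i 2) * x_var 2"
  shows "Jac (f_map (Suc n)) =
    1 - of_nat (Suc n) * t_var ^ Suc n * (const3 a11 * L 1 ^ n + const3 a22 * L 2 ^ n) +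
    of_nat (Suc n) ^ 2 * t_var ^ (2 * Suc n) * const3 (a11 * a22 - a12 * a21) * (L 1 ^ n * L 2 ^ n)"
proof -
  have "partial_x j (L i) = const3 (a_var i j)" for i j
    using exhaust_2[of j] by (auto simp: L_def partial_x_mult)
  moreover have "f_map (Suc n) i = x_var i - (t_var * L i) ^ Suc n" for i
    by (simp add: f_map_def L_def sum_2)
  ultimately have partial_f: "partial_x j (f_map (Suc n) i) =
      (if i = j then 1 else 0) - of_nat (Suc n) * t_var ^ Suc n * L i ^ n * const3 (a_var i j)" for i j
    by (simp add: partial_x_power partial_x_mult power_mult_distrib mult_ac del: power_Suc of_nat_Suc)
  have t_power: "t_var ^ (2 * Suc n) = t_var ^ Suc n * t_var ^ Suc n"
    by (simp only: mult_2 power_add)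
  show ?thesis
    unfolding t_power by (simp add: Jac_def det_2 partial_f const3_simps power2_eq_square algebra_simps
        del: power_Suc of_nat_Suc mult_Suc_right)
qed

text \<open>All pairs (k, l) with the same k + l contribute to the same monomial, so the determinant
  part remains a double sum.\<close>

lemma coeff3_Jac_f_map:
  "coeff3 (Jac (f_map (Suc n))) N p q =
    (if (N, p, q) = (0, 0, 0) then 1 else 0) -
    (\<Sum>k\<le>n. if (N, p, q) = (Suc n, k, n - k) then of_nat (Suc n) * (of_nat (n choose k) *
      (a11 * (a11 ^ k * a12 ^ (n - k)) + a22 * (a21 ^ k * a22 ^ (n - k)))) else 0) +
    (\<Sum>k\<le>n. \<Sum>l\<le>n. if (N, p, q) = (2 * Suc n, k + l, (n - k) + (n - l)) then
      of_nat (Suc n) ^ 2 * ((a11 * a22 - a12 * a21) *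
        (of_nat (n choose k) * (a11 ^ k * a12 ^ (n - k)) *
         (of_nat (n choose l) * (a21 ^ l * a22 ^ (n - l))))) else 0)"
proof -
  have "Jac (f_map (Suc n)) = const3 1 * monom3 0 0 0 -
    (\<Sum>k\<le>n. const3 (of_nat (Suc n) * (of_nat (n choose k) *
      (a11 * (a11 ^ k * a12 ^ (n - k)) + a22 * (a21 ^ k * a22 ^ (n - k))))) *
      monom3 (Suc n) k (n - k)) +
    (\<Sum>k\<le>n. \<Sum>l\<le>n.
      const3 (of_nat (Suc n) ^ 2 * ((a11 * a22 - a12 * a21) *
        (of_nat (n choose k) * (a11 ^ k * a12 ^ (n - k)) *
         (of_nat (n choose l) * (a21 ^ l * a22 ^ (n - l)))))) *
      monom3 (2 * Suc n) (k + l) ((n - k) + (n - l)))"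
    unfolding Jac_f_map linear_form_power sum_product
    unfolding sum_distrib_left sum.distrib[symmetric]
    by (intro arg_cong2[of _ _ _ _ "(+)"] arg_cong2[of _ _ _ _ "(-)"] sum.cong refl)
      (simp_all only: const3_simps(1,4-6,8) monom3_def power_add distrib_left distrib_right
        power_0 mult_1_left mult_ac)
  then show ?thesis
    by (simp add: coeff3_sum if_distrib cong: if_cong del: of_nat_Suc mult_Suc_right)
qed

section \<open>Elements of J read off from the Jacobian\<close>

lemma coeff3_Jac_f_map_mem:
  "(N, p, q) \<noteq> (0, 0, 0) \<Longrightarrow> coeff3 (Jac (f_map d)) N p q \<in> J_ideal d"
  unfolding J_ideal_def by (intro module.span_base[OF module_mult_self]) auto

text \<open>Up to sign and the unit (n+1) binom(n, k), this is the coefficient of t^(n+1) x_1^k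
  x_2^(n-k).\<close>

lemma trace_coeff_mem_J:
  assumes "k \<le> n"
  shows "a11 * (a11 ^ k * a12 ^ (n - k)) + a22 * (a21 ^ k * a22 ^ (n - k)) \<in> J_ideal (Suc n)"
    (is "?G k \<in> _")
proof -
  interpret ring_ideal "J_ideal (Suc n)" by (rule ring_ideal_J)
  have [simp]: "(k = l \<and> n - k = n - l) \<longleftrightarrow> k = l" for l
    by auto
  have "coeff3 (Jac (f_map (Suc n))) (Suc n) k (n - k) = - (of_nat (Suc n * (n choose k)) * ?G k)"
    using assms unfolding coeff3_Jac_f_map by (simp add: mult.assoc del: of_nat_Suc mult_Suc)
  then have "of_nat (Suc n * (n choose k)) * ?G k \<in> J_ideal (Suc n)"
    using coeff3_Jac_f_map_mem[of "Suc n" k "n - k" "Suc n"] uminus_mem by fastforce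
  then show ?thesis
    by (rule of_nat_mult_coeff_ring_cancel[rotated]) (use assms in auto)
qed

text \<open>In t-degree 2d the constant and the trace part contribute nothing, as 2d differs from 0
  and d.\<close>

lemma coeff3_Jac_f_map_det:
  "coeff3 (Jac (f_map (Suc n))) (2 * Suc n) p q =
    of_nat (Suc n ^ 2) * ((a11 * a22 - a12 * a21) *
      (\<Sum>k\<le>n. \<Sum>l\<le>n. if p = k + l \<and> q = (n - k) + (n - l) then
        of_nat (n choose k) * (a11 ^ k * a12 ^ (n - k)) *
        (of_nat (n choose l) * (a21 ^ l * a22 ^ (n - l))) else 0))"
  unfolding coeff3_Jac_f_map sum_distrib_left
  by (simp del: of_nat_Suc) (intro sum.cong refl, simp)

text \<open>From the coefficient of x_1^(2n) in the determinant part, to which only k = l = n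
  contributes.\<close>

lemma left_det_coeff_mem_J:
  "(a11 * a22 - a12 * a21) * (a11 ^ n * a21 ^ n) \<in> J_ideal (Suc n)" (is "?D * ?c \<in> _")
proof -
  have "coeff3 (Jac (f_map (Suc n))) (2 * Suc n) (2 * n) 0 =
      of_nat (Suc n ^ 2) * (?D * (\<Sum>k\<le>n. \<Sum>l\<le>n. if l = n then if k = n then ?c else 0 else 0))"
    unfolding coeff3_Jac_f_map_det
    by (intro arg_cong2[of _ _ _ _ "(*)"] sum.cong refl) auto
  also have "\<dots> = of_nat (Suc n ^ 2) * (?D * ?c)"
    by simp
  finally have "of_nat (Suc n ^ 2) * (?D * ?c) \<in> J_ideal (Suc n)"
    using coeff3_Jac_f_map_mem[of "2 * Suc n" "2 * n" 0 "Suc n"] by (simp only:) simp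
  then show ?thesis
    by (rule of_nat_mult_coeff_ring_cancel[rotated]) simp
qed

text \<open>From the coefficient of x_1^n x_2^n in the determinant part: it forces l = n - k, and
  the symmetry of the binomial coefficients produces the square.\<close>

lemma middle_det_coeff_mem_J:
  "(a11 * a22 - a12 * a21) *
    (\<Sum>k\<le>n. of_nat (n choose k) ^ 2 * ((a11 * a22) ^ k * (a12 * a21) ^ (n - k))) \<in> J_ideal (Suc n)"
  (is "?D * sum ?c _ \<in> _")
proof -
  have "coeff3 (Jac (f_map (Suc n))) (2 * Suc n) n n =
      of_nat (Suc n ^ 2) * (?D * (\<Sum>k\<le>n. \<Sum>l\<le>n. if l = n - k then ?c k else 0))"
    unfolding coeff3_Jac_f_map_det
    by (intro arg_cong2[of _ _ _ _ "(*)"] sum.cong refl)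
      (auto simp: power2_eq_square power_mult_distrib binomial_symmetric[symmetric] mult_ac)
  also have "\<dots> = of_nat (Suc n ^ 2) * (?D * sum ?c {..n})"
    by simp
  finally have "of_nat (Suc n ^ 2) * (?D * sum ?c {..n}) \<in> J_ideal (Suc n)"
    using coeff3_Jac_f_map_mem[of "2 * Suc n" n n "Suc n"] by (simp only:) simp
  then show ?thesis
    by (rule of_nat_mult_coeff_ring_cancel[rotated]) simp
qed

text \<open>The trace coefficient for k = n and the two determinant coefficients are the three
  hypotheses of \<open>determinant_mem_radical\<close>.\<close>

lemma det_power_mem_J:
  obtains m where "(a11 * a22 - a12 * a21) ^ m \<in> J_ideal (Suc n)"
proof -
  interpret ring_ideal "J_ideal (Suc n)" by (rule ring_ideal_J)
  have "a11 * a22 - a12 * a21 \<in> radical"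
    by (rule determinant_mem_radical[of _ n])
      (use trace_coeff_mem_J[of n n] left_det_coeff_mem_J[of n] middle_det_coeff_mem_J[of n] in simp_all)
  with that show ?thesis
    by (auto simp: radical_def)
qed

text \<open>The row i = 2 follows from the row i = 1 by exchanging the indices 1 and 2, which fixes
  the determinant and reverses the order of the trace coefficients.\<close>

lemma coeffs_in_J_combination:
  fixes G :: "2 \<Rightarrow> coeff_ring fps3"
  shows "coeffs_in (J_ideal (Suc n))
    ((\<Sum>j\<in>UNIV. const3 (a_var i j) * (\<Sum>l\<in>UNIV. const3 (a_var j l) * G l) ^ Suc n) +
      const3 ((a11 * a22 - a12 * a21) * (if i = 1 then a21 else a12) ^ n) * G i ^ Suc n)"
proof -
  interpret ring_ideal "J_ideal (Suc n)" by (rule ring_ideal_J)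
  consider "i = 1" | "i = 2"
    using exhaust_2 by blast
  then show ?thesis
  proof cases
    case 1
    show ?thesis
      using coeffs_in_combination[of n a11 a12 a22 a21 "G 1" "G 2", OF trace_coeff_mem_J] 1
      by (simp add: sum_2 del: power_Suc)
  next
    case 2
    have "a22 * (a22 ^ k * a21 ^ (n - k)) + a11 * (a12 ^ k * a11 ^ (n - k)) \<in> J_ideal (Suc n)"
      if "k \<le> n" for k
      using trace_coeff_mem_J[of "n - k" n] that by (simp add: mult_ac add_ac)
    from coeffs_in_combination[of n a22 a21 a11 a12 "G 2" "G 1", OF this] 2
    show ?thesis
      by (simp add: sum_2 mult_ac add_ac del: power_Suc)
  qed
qed

section \<open>Polynomiality of the inverse modulo J + (D^k), by induction on k\<close>

theorem mainTheorem2: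
  fixes d :: nat and g :: "2 \<Rightarrow> coeff_ring fps3"
  assumes "d \<ge> 1"
    and "formal_inverse (f_map d) g"
  shows "finite {(i, N, p, q). coeff3 (g i) N p q \<notin> J_ideal d}"
proof -
  from assms(1) obtain n where d: "d = Suc n"
    by (cases d) auto
  interpret J: ring_ideal "J_ideal d" by (rule ring_ideal_J)
  define D where "D = a11 * a22 - a12 * a21"
  define c where "c i = (if i = 1 then a21 else a12) ^ n" for i :: 2
  define y where "y i = (\<Sum>j\<in>UNIV. const3 (a_var i j) * g j)" for i
  \<comment> \<open>These ideals descend from the whole ring at k = 0 to J itself once D^k lies in
    J.\<close>
  define I where "I k = {j + D ^ k * r | j r. j \<in> J_ideal d}" for k

  have g_eq: "g i = x_var i + t_var ^ d * y i ^ d" for i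
  proof -
    have "g i - (t_var * y i) ^ d = x_var i"
      using assms(2) by (simp add: formal_inverse_def subst_x_f_map y_def)
    then show ?thesis
      by (simp add: algebra_simps power_mult_distrib)
  qed
  \<comment> \<open>All coefficients of the bracket that is multiplied by \<open>t\<^sup>d\<close> lie in \<open>J\<close>.\<close>
  have y_eq: "y i = (\<Sum>j\<in>UNIV. const3 (a_var i j) * x_var j) +
      ((\<Sum>j\<in>UNIV. const3 (a_var i j) * y j ^ d) + const3 (D * c i) * g i ^ d) * t_var ^ d +
      const3 (- c i) * t_var ^ d * (const3 D * g i ^ d)" for i
  proof -
    \<comment> \<open>Only the outer \<open>g j\<close> is rewritten by \<open>g_eq\<close>. The
      term with \<open>D * c i\<close> is added inside the bracket and removed again by the last
      summand.\<close>
    have "y i = (\<Sum>j\<in>UNIV. const3 (a_var i j) * (x_var j + t_var ^ d * y j ^ d))"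
      unfolding y_def[of i] by (simp only: g_eq[symmetric])
    then show ?thesis
      by (simp add: sum_2 const3_simps algebra_simps)
  qed
  have poly: "polynomial_mod (I k) (g i)" for k i
  proof (induction k arbitrary: i)
    case 0
    have "b \<in> I 0" for b
      unfolding I_def by (intro CollectI exI[of _ 0] exI[of _ b]) (simp add: J.zero_mem)
    then show ?case
      by (simp add: polynomial_mod_def)
  next
    case (Suc k)
    interpret I: ring_ideal "I k" unfolding I_def by (rule J.ring_ideal_adjoin)
    interpret I': ring_ideal "I (Suc k)" unfolding I_def by (rule J.ring_ideal_adjoin)
    have mon: "polynomial_mod (I (Suc k)) (const3 b)" "polynomial_mod (I (Suc k)) t_var"
      "polynomial_mod (I (Suc k)) (x_var j)" for b j
      using I'.polynomial_mod_monom[of b 0 0 0] I'.polynomial_mod_monom[of 1 1 0 0]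
      by (simp_all add: monom3_def const3_simps(8))
        (simp only: x_var_eq_monom3 I'.polynomial_mod_monom)
    \<comment> \<open>The gain in the induction: multiplication by \<open>D\<close> maps J + (D^k)
      into J + (D^(k+1)), so knowing \<open>g j\<close> modulo \<open>I k\<close> determines
      \<open>D * g j ^ d\<close> well enough modulo \<open>I (Suc k)\<close>.\<close>
    have "D * b \<in> I (Suc k)" if "b \<in> I k" for b
      using that J.mult_mem[of _ D] by (force simp: I_def algebra_simps)
    with I.polynomial_mod_power[OF Suc.IH] have "polynomial_mod (I (Suc k)) (const3 D * g j ^ d)" for j
      unfolding polynomial_mod_def coeff3_const3_mult by blast
    then have last: "polynomial_mod (I (Suc k)) (const3 (- c j) * t_var ^ d * (const3 D * g j ^ d))" for j
      by (rule I'.polynomial_mod_mult[OF I'.polynomial_mod_mult[OF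
            mon(1) I'.polynomial_mod_power[OF mon(2)]]])
    have middle: "coeffs_in (I (Suc k))
        ((\<Sum>j\<in>UNIV. const3 (a_var l j) * y j ^ d) + const3 (D * c l) * g l ^ d)" for l
    proof -
      have "J_ideal d \<subseteq> I (Suc k)"
        unfolding I_def by (intro subsetI CollectI exI[of _ 0] exI) simp
      then show ?thesis
        using coeffs_in_J_combination[of n l g]
        unfolding d y_def c_def D_def coeffs_in_def by blast
    qed
    have first: "polynomial_mod (I (Suc k)) (\<Sum>l\<in>UNIV. const3 (a_var j l) * x_var l)" for j
      unfolding sum_2 by (intro I'.polynomial_mod_add I'.polynomial_mod_mult mon)
    \<comment> \<open>The induction hypothesis enters through the last summand of
      \<open>y_eq\<close>; the claim then passes from \<open>y\<close> back to \<open>g\<close> by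
      \<open>g_eq\<close>.\<close>
    have "polynomial_mod (I (Suc k)) (y j)" for j
      by (subst y_eq) (rule I'.polynomial_mod_add[OF I'.polynomial_mod_add[OF
            first I'.polynomial_mod_if_coeffs_in[OF I'.coeffs_in_mult[OF middle]]] last])
    then show "polynomial_mod (I (Suc k)) (g i)"
      by (subst g_eq) (rule I'.polynomial_mod_add[OF mon(3) I'.polynomial_mod_mult[OF
            I'.polynomial_mod_power[OF mon(2)] I'.polynomial_mod_power]])
  qed
  obtain m where m: "D ^ m \<in> J_ideal d"
    unfolding D_def d by (rule det_power_mem_J)
  then have "I m \<subseteq> J_ideal d"
    by (auto simp: I_def intro: J.add_mem J.mult_mem_right)
  then have "finite {(N, p, q). coeff3 (g i) N p q \<notin> J_ideal d}" for i
    by (intro rev_finite_subset[OF finite_if_polynomial_mod[OF poly[of m i]]]) auto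
  then have "finite (SIGMA i:UNIV. {(N, p, q). coeff3 (g i) N p q \<notin> J_ideal d})"
    by (intro finite_SigmaI) auto
  then show ?thesis
    by (rule rev_finite_subset) auto
qed

end
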